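(* Let $G=(V,E)$ be a finite connected graph with girth at least $6$, with edges $E=\{e_1,\dots,e_n\}$, and let $\kappa^*\in\mathbb{R}^n$ be a prescribed curvature satisfying $\sum_{i=1}^n\kappa_i^*=2(|V|-|E|)$. Let $\bm\omega(t)$, $t\ge0$, be a solution of $$\frac{d}{dt}\omega_i=-(\kappa_i(\bm\omega)-\kappa_i^* )\,\omega_i,\quad i=1,\dots,n,\qquad \bm\omega(0)=\bm\omega_0\in\mathbb{R}^n_{>0}.$$ If $\bm\omega(t)$ converges as $t\to\infty$, then weights of $\kappa^*$ exist, i.e. there is $\bm\omega^*\in\mathbb{R}^n_{>0}$ with $\kappa_i(\bm\omega^* )=\kappa_i^*$ for all $i$. Moreover, the limit of $\bm\omega(t)$ is such a weight of $\kappa^*$.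
   Context: Graphs are finite, connected, undirected and simple. The girth is the length of a shortest cycle; girth at least $6$ means there are no cycles of length $3$, $4$ or $5$ (trees are included). A weight is a vector $\bm\omega=(\omega_1,\dots,\omega_n)\in\mathbb{R}^n_{>0}$ with $\omega_i=\omega(e_i)$; $\omega_{xy}=\omega_{yx}$ is the weight of edge $(x,y)$. Write $y\sim x$ if $(x,y)\in E$, and $m(x)=\sum_{y\sim x}\omega_{xy}$. The distance $d(u,v)$ is the combinatorial one (number of edges of a shortest path) and does not depend on the weights or on time. Convergence of $\bm\omega(t)$ means convergence in $\mathbb{R}^n$ to a finite limit. Lin-Lu-Yau curvature: for $x\in V$ and $\alpha\in(0,1)$ let $m_x^\alpha$ be the probability measure with $m_x^\alpha(x)=\alpha$, $m_x^\alpha(y)=(1-\alpha)\omega_{xy}/m(x)$ for $y\sim x$, and $0$ otherwise. For an edge $e_i=(x,y)$, $\kappa_i(\bm\omega)=\lim_{\alpha\to1^-}\frac{1}{1-\alpha}\left(1-W(m_x^\alpha,m_y^\alpha)\right)$, where $W$ is the $1$-Wasserstein distance with respect to $d$. On a graph with girth at least $6$ one has, for every edge $e=(x,y)$, $\kappa_e=2\omega_e\left(\frac1{m(x)}+\frac1{m(y)}\right)-2$. *)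

theory Defs
  imports "HOL-Analysis.Analysis" "HOL-Library.Extended_Nat"
begin

definition simple_graph :: "'v set \<Rightarrow> 'v set set \<Rightarrow> bool" where
  "simple_graph V E \<longleftrightarrow> finite V \<and> (\<forall>a\<in>E. a \<subseteq> V \<and> card a = 2)"

text \<open>Paths are lists of pairwise distinct vertices, so a path \<open>xs\<close> has \<open>length xs - 1\<close> edges.\<close>

definition graph_path :: "'v set \<Rightarrow> 'v set set \<Rightarrow> 'v list \<Rightarrow> 'v \<Rightarrow> 'v \<Rightarrow> bool" where
  "graph_path V E xs u v \<longleftrightarrow>
     xs \<noteq> [] \<and> set xs \<subseteq> V \<and> distinct xs \<and> hd xs = u \<and> last xs = v
     \<and> successively (\<lambda>a b. {a, b} \<in> E) xs"

definition graph_connected :: "'v set \<Rightarrow> 'v set set \<Rightarrow> bool" where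
  "graph_connected V E \<longleftrightarrow> V \<noteq> {} \<and> (\<forall>u\<in>V. \<forall>v\<in>V. \<exists>xs. graph_path V E xs u v)"

definition graph_dist :: "'v set \<Rightarrow> 'v set set \<Rightarrow> 'v \<Rightarrow> 'v \<Rightarrow> nat" where
  "graph_dist V E u v = (LEAST k. \<exists>xs. graph_path V E xs u v \<and> k = length xs - 1)"

text \<open>A cycle is given by its distinct vertices in cyclic order; its length is their number.\<close>

definition graph_cycle :: "'v set \<Rightarrow> 'v set set \<Rightarrow> 'v list \<Rightarrow> bool" where
  "graph_cycle V E xs \<longleftrightarrow>
     3 \<le> length xs \<and> set xs \<subseteq> V \<and> distinct xs
     \<and> successively (\<lambda>a b. {a, b} \<in> E) xs \<and> {last xs, hd xs} \<in> E"

text \<open>The girth of an acyclic graph is \<open>\<infinity>\<close>.\<close>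

definition girth :: "'v set \<Rightarrow> 'v set set \<Rightarrow> enat" where
  "girth V E = (INF xs\<in>{xs. graph_cycle V E xs}. enat (length xs))"

text \<open>
  An edge enumeration is a bijection \<open>e\<close> from a finite index type \<open>'n\<close> onto the edge set \<open>E\<close>,
  so that a weight is a vector in \<open>real ^ 'n\<close>. Index types are nonempty; a
  connected graph without edges is a single vertex, for which the total curvature condition of the
  theorem would read \<open>0 = 2\<close>.
\<close>

definition edge_weight :: "('n::finite \<Rightarrow> 'v set) \<Rightarrow> real ^ 'n \<Rightarrow> 'v \<Rightarrow> 'v \<Rightarrow> real" where
  "edge_weight e w x y = w $ (inv e {x, y})"

definition vertex_mass ::
  "'v set \<Rightarrow> 'v set set \<Rightarrow> ('n::finite \<Rightarrow> 'v set) \<Rightarrow> real ^ 'n \<Rightarrow> 'v \<Rightarrow> real" where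
  "vertex_mass V E e w x = (\<Sum>y\<in>{y\<in>V. {x, y} \<in> E}. edge_weight e w x y)"

text \<open>Probability measures on the finite set \<open>V\<close> are represented by their mass functions.\<close>

definition lazy_measure ::
  "'v set \<Rightarrow> 'v set set \<Rightarrow> ('n::finite \<Rightarrow> 'v set) \<Rightarrow> real ^ 'n \<Rightarrow> real \<Rightarrow> 'v \<Rightarrow> 'v \<Rightarrow> real" where
  "lazy_measure V E e w \<alpha> x z =
     (if z = x then \<alpha>
      else if {x, z} \<in> E then (1 - \<alpha>) * edge_weight e w x z / vertex_mass V E e w x
      else 0)"

definition couplings :: "'v set \<Rightarrow> ('v \<Rightarrow> real) \<Rightarrow> ('v \<Rightarrow> real) \<Rightarrow> ('v \<Rightarrow> 'v \<Rightarrow> real) set" where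
  "couplings V \<mu> \<nu> =
     {\<pi>. (\<forall>u\<in>V. \<forall>v\<in>V. 0 \<le> \<pi> u v)
        \<and> (\<forall>u\<in>V. (\<Sum>v\<in>V. \<pi> u v) = \<mu> u)
        \<and> (\<forall>v\<in>V. (\<Sum>u\<in>V. \<pi> u v) = \<nu> v)}"

definition wasserstein1 :: "'v set \<Rightarrow> 'v set set \<Rightarrow> ('v \<Rightarrow> real) \<Rightarrow> ('v \<Rightarrow> real) \<Rightarrow> real" where
  "wasserstein1 V E \<mu> \<nu> =
     (INF \<pi>\<in>couplings V \<mu> \<nu>. \<Sum>u\<in>V. \<Sum>v\<in>V. real (graph_dist V E u v) * \<pi> u v)"

text \<open>
  The Lin-Lu-Yau curvature vector. The quotient is symmetric in \<open>x\<close> and \<open>y\<close>, so its limit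
  does not depend on which end of the edge is called \<open>x\<close>.
\<close>

definition lly_curvature ::
  "'v set \<Rightarrow> 'v set set \<Rightarrow> ('n::finite \<Rightarrow> 'v set) \<Rightarrow> real ^ 'n \<Rightarrow> real ^ 'n" where
  "lly_curvature V E e w =
     (\<chi> i. THE k. \<forall>x y. e i = {x, y} \<longrightarrow>
        ((\<lambda>\<alpha>. 1 / (1 - \<alpha>) *
             (1 - wasserstein1 V E (lazy_measure V E e w \<alpha> x) (lazy_measure V E e w \<alpha> y)))
          \<longlongrightarrow> k) (at_left 1))"

definition positive_weight :: "real ^ 'n::finite \<Rightarrow> bool" where
  "positive_weight w \<longleftrightarrow> (\<forall>i. 0 < w $ i)"

text \<open>
  The curvature is only defined for positive weights, so a solution is required to stay in the
  open positive orthant; at \<open>t = 0\<close> the derivative is one-sided.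
\<close>

definition flow_solution ::
  "'v set \<Rightarrow> 'v set set \<Rightarrow> ('n::finite \<Rightarrow> 'v set) \<Rightarrow> real ^ 'n \<Rightarrow> real ^ 'n
    \<Rightarrow> (real \<Rightarrow> real ^ 'n) \<Rightarrow> bool" where
  "flow_solution V E e \<kappa>s w0 w \<longleftrightarrow>
     w 0 = w0 \<and>
     (\<forall>t\<ge>0. positive_weight (w t) \<and>
        (w has_vector_derivative
          (\<chi> i. - (lly_curvature V E e (w t) $ i - \<kappa>s $ i) * w t $ i)) (at t within {0..}))"

definition weight_of_curvature ::
  "'v set \<Rightarrow> 'v set set \<Rightarrow> ('n::finite \<Rightarrow> 'v set) \<Rightarrow> real ^ 'n \<Rightarrow> real ^ 'n \<Rightarrow> bool" where
  "weight_of_curvature V E e \<kappa>s w \<longleftrightarrow>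
     positive_weight w \<and> (\<forall>i. lly_curvature V E e w $ i = \<kappa>s $ i)"

end

theory Submission
  imports Defs
begin

text \<open>
  Write \<open>m x\<close> for the mass of a vertex. The curvature of an edge \<open>{x, y}\<close> of weight \<open>a\<close> in a graph
  of girth at least six is \<open>2 * a * (1 / m x + 1 / m y) - 2\<close> (\<open>lly_curvature_formula\<close>). To see this,
  take a neighbour \<open>x'\<close> of \<open>x\<close> and a neighbour \<open>y'\<close> of \<open>y\<close>, off the edge. There is no short
  cycle, so \<open>x', x, y, y'\<close> is a shortest path. The potential with values \<open>2, 1, 0, -1\<close> on such paths
  realises their distances, and Kantorovich duality gives the Wasserstein distance of the
  two lazy measures exactly, for all laziness parameters above \<open>1/2\<close>
  (\<open>wasserstein1_eq_potential_difference\<close>, \<open>wasserstein1_lazy\<close>).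

  Summing the formula over the edges and regrouping by vertices, the total curvature is
  \<open>2 * (card V - card E)\<close> for every positive weight (\<open>total_curvature\<close>). If the prescribed curvature
  has the same total, the logarithms of the weights have a constant sum along the flow, so the
  product of the weights is conserved (\<open>flow_product_conserved\<close>). A limit therefore cannot lie on
  the boundary of the positive orthant (\<open>flow_limit_positive\<close>); this is the one point where
  the flow could fail to produce a weight of the prescribed curvature.
  Inside the orthant the curvature is continuous. Each logarithm of a weight
  then converges together with its derivative, so the derivative tends to \<open>0\<close>, and its limit is the
  difference of the prescribed curvature and the curvature of the limit (\<open>flow_limit_curvature\<close>).
\<close>

section \<open>Optimal transport on a finite graph\<close>

lemma coupling_zero:
  assumes fin: "finite V" and pi: "\<pi> \<in> couplings V \<mu> \<nu>" and u: "u \<in> V" and v: "v \<in> V"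
    and z: "\<mu> u = 0 \<or> \<nu> v = 0"
  shows "\<pi> u v = 0"
proof -
  have nn: "\<And>a b. a \<in> V \<Longrightarrow> b \<in> V \<Longrightarrow> 0 \<le> \<pi> a b"
    using pi by (auto simp: couplings_def)
  from z show ?thesis
  proof
    assume "\<mu> u = 0"
    then have "(\<Sum>b\<in>V. \<pi> u b) = 0" using pi u by (auto simp: couplings_def)
    then show ?thesis using sum_nonneg_eq_0_iff[OF fin, of "\<pi> u"] nn u v by auto
  next
    assume "\<nu> v = 0"
    then have "(\<Sum>a\<in>V. \<pi> a v) = 0" using pi v by (auto simp: couplings_def)
    then show ?thesis using sum_nonneg_eq_0_iff[OF fin, of "\<lambda>a. \<pi> a v"] nn u v by auto
  qed
qed

lemma coupling_potential_difference:
  assumes pi: "\<pi> \<in> couplings V \<mu> \<nu>"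
  shows "(\<Sum>u\<in>V. \<Sum>v\<in>V. (f u - f v) * \<pi> u v) = (\<Sum>u\<in>V. f u * \<mu> u) - (\<Sum>v\<in>V. f v * \<nu> v)"
proof -
  have "(\<Sum>u\<in>V. \<Sum>v\<in>V. (f u - f v) * \<pi> u v)
      = (\<Sum>u\<in>V. \<Sum>v\<in>V. f u * \<pi> u v) - (\<Sum>u\<in>V. \<Sum>v\<in>V. f v * \<pi> u v)"
    by (simp add: left_diff_distrib sum_subtractf)
  also have "(\<Sum>u\<in>V. \<Sum>v\<in>V. f u * \<pi> u v) = (\<Sum>u\<in>V. f u * \<mu> u)"
    using pi by (intro sum.cong) (auto simp: couplings_def sum_distrib_left[symmetric])
  also have "(\<Sum>u\<in>V. \<Sum>v\<in>V. f v * \<pi> u v) = (\<Sum>v\<in>V. f v * \<nu> v)"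
    using pi by (subst sum.swap, intro sum.cong)
      (auto simp: couplings_def sum_distrib_left[symmetric])
  finally show ?thesis .
qed

text \<open>
  The mass common to both measures stays where it is, and the excess of \<open>\<mu>\<close> is spread over the
  excess of \<open>\<nu>\<close> as by a product measure. Only pairs from an excess point of \<open>\<mu>\<close> to an excess point
  of \<open>\<nu>\<close> are then matched off the diagonal. If the measures agree, the division by the total
  excess \<open>0\<close> gives the diagonal coupling.
\<close>

lemma excess_coupling:
  fixes \<mu> \<nu> :: "'v \<Rightarrow> real"
  assumes fin: "finite V"
    and nn: "\<And>u. u \<in> V \<Longrightarrow> 0 \<le> \<mu> u" "\<And>u. u \<in> V \<Longrightarrow> 0 \<le> \<nu> u"
    and mass: "sum \<mu> V = sum \<nu> V"
  obtains \<pi> where "\<pi> \<in> couplings V \<mu> \<nu>"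
    and "\<And>u v. u \<in> V \<Longrightarrow> v \<in> V \<Longrightarrow> \<pi> u v \<noteq> 0 \<Longrightarrow> u \<noteq> v \<Longrightarrow> \<nu> u < \<mu> u \<and> \<mu> v < \<nu> v"
proof -
  define \<rho> where "\<rho> u = min (\<mu> u) (\<nu> u)" for u
  define T where "T = (\<Sum>u\<in>V. \<mu> u - \<rho> u)"
  define \<pi> where "\<pi> u v = (if u = v then \<rho> u else 0) + (\<mu> u - \<rho> u) * (\<nu> v - \<rho> v) / T" for u v
  have T': "T = (\<Sum>u\<in>V. \<nu> u - \<rho> u)"
    unfolding T_def using mass by (simp add: sum_subtractf)
  have ex: "0 \<le> \<mu> u - \<rho> u" "0 \<le> \<nu> u - \<rho> u" for u
    by (auto simp: \<rho>_def)
  have T0: "0 \<le> T"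
    unfolding T_def using ex by (intro sum_nonneg) auto
  have cancel: "(\<mu> u - \<rho> u) * T / T = \<mu> u - \<rho> u" "(\<nu> u - \<rho> u) * T / T = \<nu> u - \<rho> u" if "u \<in> V" for u
    using that sum_nonneg_eq_0_iff[OF fin, of "\<lambda>u. \<mu> u - \<rho> u"]
      sum_nonneg_eq_0_iff[OF fin, of "\<lambda>u. \<nu> u - \<rho> u"] ex T_def T' by (cases "T = 0"; auto)+
  have row: "(\<Sum>v\<in>V. \<pi> u v) = \<mu> u" if u: "u \<in> V" for u
  proof -
    have "(\<Sum>v\<in>V. \<pi> u v) = \<rho> u + (\<mu> u - \<rho> u) * T / T"
      using u fin unfolding \<pi>_def T'
      by (simp add: sum.distrib sum_distrib_left sum_divide_distrib)
    then show ?thesis using cancel[OF u] by simp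
  qed
  have col: "(\<Sum>u\<in>V. \<pi> u v) = \<nu> v" if v: "v \<in> V" for v
  proof -
    have "(\<Sum>u\<in>V. \<pi> u v) = \<rho> v + T * (\<nu> v - \<rho> v) / T"
      using v fin unfolding \<pi>_def T_def
      by (simp add: sum.distrib sum_distrib_right sum_divide_distrib)
    then show ?thesis using cancel[OF v] by (simp add: mult.commute)
  qed
  have "0 \<le> \<pi> u v" if "u \<in> V" "v \<in> V" for u v
    using that nn ex T0 by (auto simp: \<pi>_def \<rho>_def intro!: add_nonneg_nonneg divide_nonneg_nonneg mult_nonneg_nonneg)
  then have "\<pi> \<in> couplings V \<mu> \<nu>"
    using row col by (auto simp: couplings_def)
  moreover have "\<nu> u < \<mu> u \<and> \<mu> v < \<nu> v" if "\<pi> u v \<noteq> 0" "u \<noteq> v" for u v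
    using that by (auto simp: \<pi>_def \<rho>_def min_def split: if_splits)
  ultimately show thesis using that by blast
qed

text \<open>
  Complementary slackness: a potential \<open>f\<close> that is 1-Lipschitz from the support of \<open>\<mu>\<close> to the
  support of \<open>\<nu>\<close> bounds every transport cost from below by the difference of its means, and
  the coupling that moves only excess mass attains the bound if \<open>f\<close> is tight on the pairs it uses.
\<close>

lemma wasserstein1_eq_potential_difference:
  fixes f :: "'v \<Rightarrow> real"
  assumes fin: "finite V"
    and nn: "\<And>u. u \<in> V \<Longrightarrow> 0 \<le> \<mu> u" "\<And>u. u \<in> V \<Longrightarrow> 0 \<le> \<nu> u"
    and mass: "sum \<mu> V = sum \<nu> V"
    and lip: "\<And>u v. u \<in> V \<Longrightarrow> v \<in> V \<Longrightarrow> \<mu> u \<noteq> 0 \<Longrightarrow> \<nu> v \<noteq> 0 \<Longrightarrow> f u - f v \<le> graph_dist V E u v"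
    and diag: "\<And>u. u \<in> V \<Longrightarrow> graph_dist V E u u = 0"
    and tight: "\<And>u v. u \<in> V \<Longrightarrow> v \<in> V \<Longrightarrow> \<nu> u < \<mu> u \<Longrightarrow> \<mu> v < \<nu> v \<Longrightarrow>
      graph_dist V E u v \<le> f u - f v"
  shows "wasserstein1 V E \<mu> \<nu> = (\<Sum>u\<in>V. f u * \<mu> u) - (\<Sum>v\<in>V. f v * \<nu> v)" (is "_ = ?D")
proof -
  let ?cost = "\<lambda>\<pi>. \<Sum>u\<in>V. \<Sum>v\<in>V. real (graph_dist V E u v) * \<pi> u v"
  have lower: "?D \<le> ?cost \<sigma>" if s: "\<sigma> \<in> couplings V \<mu> \<nu>" for \<sigma>
  proof -
    have "(\<Sum>u\<in>V. \<Sum>v\<in>V. (f u - f v) * \<sigma> u v) \<le> ?cost \<sigma>"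
    proof (intro sum_mono)
      fix u v assume uv: "u \<in> V" "v \<in> V"
      have "0 \<le> \<sigma> u v" using s uv by (auto simp: couplings_def)
      then show "(f u - f v) * \<sigma> u v \<le> real (graph_dist V E u v) * \<sigma> u v"
        using lip[OF uv] coupling_zero[OF fin s uv]
        by (cases "\<mu> u = 0 \<or> \<nu> v = 0") (auto intro!: mult_right_mono)
    qed
    then show ?thesis using coupling_potential_difference[OF s, of f] by simp
  qed
  obtain \<pi> where pi: "\<pi> \<in> couplings V \<mu> \<nu>"
    and supp: "\<And>u v. u \<in> V \<Longrightarrow> v \<in> V \<Longrightarrow> \<pi> u v \<noteq> 0 \<Longrightarrow> u \<noteq> v \<Longrightarrow> \<nu> u < \<mu> u \<and> \<mu> v < \<nu> v"
    using excess_coupling[OF fin nn mass] by blast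
  have "?cost \<pi> \<le> (\<Sum>u\<in>V. \<Sum>v\<in>V. (f u - f v) * \<pi> u v)"
  proof (intro sum_mono)
    fix u v assume uv: "u \<in> V" "v \<in> V"
    have "0 \<le> \<pi> u v" using pi uv by (auto simp: couplings_def)
    moreover have "real (graph_dist V E u v) \<le> f u - f v" if "\<pi> u v \<noteq> 0"
      using supp[OF uv that] tight[OF uv] diag[of u] uv by (cases "u = v") auto
    ultimately show "real (graph_dist V E u v) * \<pi> u v \<le> (f u - f v) * \<pi> u v"
      by (cases "\<pi> u v = 0") (auto intro!: mult_right_mono)
  qed
  then have "?cost \<pi> = ?D"
    using coupling_potential_difference[OF pi, of f] lower[OF pi] by simp
  then show ?thesis
    unfolding wasserstein1_def using lower pi
    by (intro cInf_eq_minimum) (auto simp: image_iff intro!: bexI[of _ \<pi>])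
qed

section \<open>Distances near an edge in a graph of girth at least six\<close>

locale girth_six_graph =
  fixes V :: "'v set" and E :: "'v set set" and e :: "'n::finite \<Rightarrow> 'v set"
  assumes simple: "simple_graph V E"
    and conn: "graph_connected V E"
    and girth: "6 \<le> girth V E"
    and enum: "bij_betw e UNIV E"
begin

lemma finite_vertices [simp]: "finite V"
  using simple by (simp add: simple_graph_def)

lemma edgeD: "{a, b} \<in> E \<Longrightarrow> a \<noteq> b \<and> a \<in> V \<and> b \<in> V"
  using simple by (force simp: simple_graph_def)

lemma enum_edge: "e i \<in> E" "e i \<subseteq> V"
  using enum simple by (auto simp: bij_betw_def simple_graph_def)

lemma enum_inj: "inj e"
  using enum by (simp add: bij_betw_def)

lemma enum_inv: "a \<in> E \<Longrightarrow> e (inv e a) = a"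
  using enum by (simp add: bij_betw_def f_inv_into_f)

lemma enum_ends:
  obtains x y where "e i = {x, y}"
proof -
  have "card (e i) = 2" using enum_edge(1)[of i] simple by (simp add: simple_graph_def)
  then show thesis using that by (auto simp: card_2_iff)
qed

lemma cycle_length: "graph_cycle V E xs \<Longrightarrow> 6 \<le> length xs"
proof -
  assume "graph_cycle V E xs"
  then have "girth V E \<le> enat (length xs)"
    unfolding girth_def by (intro INF_lower) simp
  with girth have "6 \<le> enat (length xs)" by (rule order_trans)
  then show ?thesis by (simp add: numeral_eq_enat)
qed

lemma no_triangle: "{a, b} \<in> E \<Longrightarrow> {b, c} \<in> E \<Longrightarrow> {c, a} \<in> E \<Longrightarrow> False"
  using cycle_length[of "[a, b, c]"] edgeD[of a b] edgeD[of b c] edgeD[of c a]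
  by (auto simp: graph_cycle_def)

lemma no_square:
  "{a, b} \<in> E \<Longrightarrow> {b, c} \<in> E \<Longrightarrow> {c, d} \<in> E \<Longrightarrow> {d, a} \<in> E \<Longrightarrow> a \<noteq> c \<Longrightarrow> b \<noteq> d \<Longrightarrow> False"
  using cycle_length[of "[a, b, c, d]"] edgeD[of a b] edgeD[of b c] edgeD[of c d] edgeD[of d a]
  by (auto simp: graph_cycle_def)

lemma no_pentagon:
  "{a, b} \<in> E \<Longrightarrow> {b, c} \<in> E \<Longrightarrow> {c, d} \<in> E \<Longrightarrow> {d, p} \<in> E \<Longrightarrow> {p, a} \<in> E \<Longrightarrow>
    distinct [a, b, c, d, p] \<Longrightarrow> False"
  using cycle_length[of "[a, b, c, d, p]"] edgeD[of a b] edgeD[of b c] edgeD[of c d] edgeD[of d p]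
  by (auto simp: graph_cycle_def)

abbreviation "dist_G \<equiv> graph_dist V E"

lemma dist_le_path: "graph_path V E xs u v \<Longrightarrow> dist_G u v \<le> length xs - 1"
  unfolding graph_dist_def by (rule Least_le) blast

lemma shortest_path:
  assumes "u \<in> V" "v \<in> V"
  obtains xs where "graph_path V E xs u v" "length xs = Suc (dist_G u v)"
proof -
  have "\<exists>k xs. graph_path V E xs u v \<and> k = length xs - 1"
    using conn assms by (auto simp: graph_connected_def)
  then have "\<exists>xs. graph_path V E xs u v \<and> dist_G u v = length xs - 1"
    unfolding graph_dist_def by (rule LeastI_ex)
  then obtain xs where "graph_path V E xs u v" "dist_G u v = length xs - 1" by blast
  moreover from this have "length xs \<noteq> 0" by (auto simp: graph_path_def)
  ultimately show thesis using that by simp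
qed

lemma dist_zeroD: "u \<in> V \<Longrightarrow> v \<in> V \<Longrightarrow> dist_G u v = 0 \<Longrightarrow> u = v"
  by (erule (1) shortest_path) (auto simp: graph_path_def length_Suc_conv)

lemma dist_oneD: "u \<in> V \<Longrightarrow> v \<in> V \<Longrightarrow> dist_G u v = 1 \<Longrightarrow> {u, v} \<in> E"
  by (erule (1) shortest_path) (auto simp: graph_path_def length_Suc_conv)

lemma dist_twoD: "u \<in> V \<Longrightarrow> v \<in> V \<Longrightarrow> dist_G u v = 2 \<Longrightarrow> \<exists>z. {u, z} \<in> E \<and> {z, v} \<in> E"
  by (erule (1) shortest_path) (auto simp: graph_path_def length_Suc_conv numeral_2_eq_2)

lemma dist_self: "u \<in> V \<Longrightarrow> dist_G u u = 0"
  using dist_le_path[of "[u]" u u] by (simp add: graph_path_def)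

lemma dist_edge: "{u, v} \<in> E \<Longrightarrow> dist_G u v = 1"
  using dist_le_path[of "[u, v]" u v] edgeD[of u v] dist_zeroD[of u v]
  by (cases "dist_G u v") (auto simp: graph_path_def)

lemma dist_two_edges:
  assumes "{u, z} \<in> E" "{z, v} \<in> E" "u \<noteq> v"
  shows "dist_G u v = 2"
proof -
  have "dist_G u v \<le> 2"
    using assms edgeD[of u z] edgeD[of z v] dist_le_path[of "[u, z, v]" u v]
    by (auto simp: graph_path_def)
  moreover have "dist_G u v \<noteq> 0" "dist_G u v \<noteq> 1"
    using assms edgeD[of u z] edgeD[of z v] dist_zeroD[of u v] dist_oneD[of u v]
      no_triangle[of u z v] by (auto simp: insert_commute)
  ultimately show ?thesis by simp
qed

text \<open>
  Here the girth hypothesis enters with full strength: distance \<open>0\<close>, \<open>1\<close> or \<open>2\<close> would close a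
  triangle, a square or a pentagon; a midpoint at \<open>x\<close> or \<open>y\<close> would close a triangle.
\<close>

lemma dist_three_edges:
  assumes "{u, x} \<in> E" "{x, y} \<in> E" "{y, v} \<in> E" "u \<noteq> y" "x \<noteq> v"
  shows "dist_G u v = 3"
proof -
  note edges = edgeD[OF assms(1)] edgeD[OF assms(2)] edgeD[OF assms(3)]
  have uv: "u \<noteq> v"
    using no_triangle[of u x y] assms by (auto simp: insert_commute)
  have "dist_G u v \<le> 3"
    using assms edges uv dist_le_path[of "[u, x, y, v]" u v] by (auto simp: graph_path_def)
  moreover have "dist_G u v \<noteq> 0" using dist_zeroD uv edges by blast
  moreover have "dist_G u v \<noteq> 1"
    using dist_oneD[of u v] no_square[of u x y v] assms edges by (auto simp: insert_commute)
  moreover have "dist_G u v \<noteq> 2"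
  proof
    assume "dist_G u v = 2"
    then obtain z where z: "{u, z} \<in> E" "{z, v} \<in> E" using dist_twoD edges by blast
    have "z \<noteq> x" using z no_triangle[of x y v] assms by (auto simp: insert_commute)
    moreover have "z \<noteq> y" using z no_triangle[of u x y] assms by (auto simp: insert_commute)
    ultimately show False
      using no_pentagon[of u x y v z] z assms edges uv edgeD[OF z(1)] edgeD[OF z(2)]
      by (auto simp: insert_commute)
  qed
  ultimately show ?thesis by simp
qed

lemma ex_neighbour:
  assumes x: "x \<in> V"
  shows "\<exists>y. {x, y} \<in> E"
proof -
  obtain a b where "e undefined = {a, b}" by (rule enum_ends)
  then have "{a, b} \<in> E" using enum_edge(1) by metis
  then obtain v where v: "v \<in> V" "v \<noteq> x" using edgeD by blast
  obtain xs where "graph_path V E xs x v" using conn x v by (auto simp: graph_connected_def)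
  then show ?thesis using v
    by (cases xs; cases "tl xs") (auto simp: graph_path_def)
qed

section \<open>The curvature formula\<close>

abbreviation nbrs :: "'v \<Rightarrow> 'v set" where "nbrs x \<equiv> {y \<in> V. {x, y} \<in> E}"

abbreviation "wt \<equiv> edge_weight e"

abbreviation "mass \<equiv> vertex_mass V E e"

lemma mass_pos: "positive_weight w \<Longrightarrow> x \<in> V \<Longrightarrow> 0 < mass w x"
  unfolding vertex_mass_def using ex_neighbour[of x] edgeD
  by (intro sum_pos) (auto simp: positive_weight_def edge_weight_def)

lemma wt_le_mass: "positive_weight w \<Longrightarrow> {x, y} \<in> E \<Longrightarrow> wt w x y \<le> mass w x"
  unfolding vertex_mass_def using edgeD[of x y]
  by (intro member_le_sum) (auto simp: positive_weight_def edge_weight_def less_imp_le)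

lemma wt_sym: "wt w x y = wt w y x"
  by (simp add: edge_weight_def insert_commute)

lemma lazy_measure_mean:
  assumes "x \<in> V"
  shows "(\<Sum>z\<in>V. g z * lazy_measure V E e w \<alpha> x z)
    = \<alpha> * g x + (1 - \<alpha>) * (\<Sum>z\<in>nbrs x. g z * wt w x z) / mass w x"
proof -
  have "(\<Sum>z\<in>V. g z * lazy_measure V E e w \<alpha> x z)
     = (\<Sum>z\<in>V. (if z = x then \<alpha> * g x else 0) +
          (if {x, z} \<in> E then (1 - \<alpha>) * (g z * wt w x z) / mass w x else 0))"
    using edgeD[of x x] by (intro sum.cong) (auto simp: lazy_measure_def)
  also have "\<dots> = \<alpha> * g x + (\<Sum>z\<in>nbrs x. (1 - \<alpha>) * (g z * wt w x z) / mass w x)"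
    using assms by (simp add: sum.distrib sum.inter_filter[symmetric])
  also have "\<dots> = \<alpha> * g x + (1 - \<alpha>) * (\<Sum>z\<in>nbrs x. g z * wt w x z) / mass w x"
    by (simp add: sum_distrib_left sum_divide_distrib)
  finally show ?thesis .
qed

lemma lazy_measure_total:
  assumes "positive_weight w" "x \<in> V"
  shows "sum (lazy_measure V E e w \<alpha> x) V = 1"
  using lazy_measure_mean[OF assms(2), of "\<lambda>_. 1" w \<alpha>] mass_pos[OF assms]
  by (simp add: vertex_mass_def)

lemma lazy_measure_nonneg:
  assumes "positive_weight w" "x \<in> V" "0 < \<alpha>" "\<alpha> < 1"
  shows "0 \<le> lazy_measure V E e w \<alpha> x z"
  using assms mass_pos[OF assms(1,2)]
  by (auto simp: lazy_measure_def positive_weight_def edge_weight_def less_imp_le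
      intro!: divide_nonneg_pos mult_nonneg_nonneg)

text \<open>
  The potential takes the values \<open>2, 1, 0, -1\<close> along every path \<open>x', x, y, y'\<close> through the edge,
  so that it realises all distances from left to right. Only the pair \<open>(y, x)\<close> of points in the two
  supports runs against this direction. As \<open>\<alpha> > 1/2\<close>, the first measure exceeds the second at \<open>x\<close>
  and falls below it at \<open>y\<close>, so no mass has to leave \<open>y\<close> or to enter \<open>x\<close>.
\<close>

lemma wasserstein1_lazy:
  assumes pos: "positive_weight w" and xy: "{x, y} \<in> E" and a: "1 / 2 < \<alpha>" "\<alpha> < 1"
  shows "wasserstein1 V E (lazy_measure V E e w \<alpha> x) (lazy_measure V E e w \<alpha> y)
    = 1 - (1 - \<alpha>) * (2 * wt w x y * (1 / mass w x + 1 / mass w y) - 2)"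
proof -
  let ?\<mu> = "lazy_measure V E e w \<alpha> x" and ?\<nu> = "lazy_measure V E e w \<alpha> y"
  define f :: "'v \<Rightarrow> real"
    where "f z = (if z = x then 1 else if z = y then 0 else if {x, z} \<in> E then 2 else -1)" for z
  have V: "x \<in> V" "y \<in> V" "x \<noteq> y" using edgeD[OF xy] by auto
  have yx: "{y, x} \<in> E" using xy by (simp add: insert_commute)
  note m = mass_pos[OF pos V(1)] mass_pos[OF pos V(2)]
  have f_left: "f z = 2" if "{x, z} \<in> E" "z \<noteq> y" for z
    using that edgeD[of x z] by (auto simp: f_def)
  have f_right: "f z = -1" if "{y, z} \<in> E" "z \<noteq> x" for z
    using that edgeD[of y z] no_triangle[of x y z] xy by (auto simp: f_def insert_commute)
  have f_x: "f x = 1" and f_y: "f y = 0" using V by (auto simp: f_def)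
  have exact: "dist_G u v = f u - f v"
    if u: "u = x \<or> {x, u} \<in> E \<and> u \<noteq> y" and v: "v = y \<or> {y, v} \<in> E \<and> v \<noteq> x" for u v
    using u
  proof (elim disjE conjE)
    assume [simp]: "u = x"
    show ?thesis using v
    proof (elim disjE conjE)
      show ?thesis if "v = y" using that dist_edge[OF xy] by (simp add: f_x f_y)
      show ?thesis if "{y, v} \<in> E" "v \<noteq> x"
        using that dist_two_edges[OF xy that(1)] by (simp add: f_x f_right)
    qed
  next
    assume xu: "{x, u} \<in> E" "u \<noteq> y"
    then have ux: "{u, x} \<in> E" by (simp add: insert_commute)
    show ?thesis using v
    proof (elim disjE conjE)
      show ?thesis if "v = y" using that xu dist_two_edges[OF ux xy] by (simp add: f_y f_left)
      show ?thesis if "{y, v} \<in> E" "v \<noteq> x"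
        using that xu dist_three_edges[OF ux xy that(1)] by (simp add: f_left f_right)
    qed
  qed
  have supp_x: "u = y \<or> u = x \<or> {x, u} \<in> E \<and> u \<noteq> y" if "?\<mu> u \<noteq> 0" for u
    using that by (auto simp: lazy_measure_def split: if_splits)
  have supp_y: "v = x \<or> v = y \<or> {y, v} \<in> E \<and> v \<noteq> x" if "?\<nu> v \<noteq> 0" for v
    using that by (auto simp: lazy_measure_def split: if_splits)
  have lip: "f u - f v \<le> dist_G u v" if u: "?\<mu> u \<noteq> 0" and v: "?\<nu> v \<noteq> 0" for u v
  proof -
    consider "u = y" | "v = x" | "dist_G u v = f u - f v"
      using supp_x[OF u] supp_y[OF v] exact by blast
    then show ?thesis
    proof cases
      case 1
      then show ?thesis
        using supp_y[OF v] f_x f_y f_right[of v] dist_edge[of y v] by (elim disjE) auto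
    next
      case 2
      then show ?thesis
        using supp_x[OF u] f_x f_y f_left[of u] dist_edge[of u x]
        by (elim disjE) (auto simp: insert_commute[of u x])
    next
      case 3
      then show ?thesis by simp
    qed
  qed
  have "(1 - \<alpha>) * wt w x y / mass w x \<le> 1 - \<alpha>" "(1 - \<alpha>) * wt w y x / mass w y \<le> 1 - \<alpha>"
    using wt_le_mass[OF pos xy] wt_le_mass[OF pos yx] m a by (auto simp: divide_le_eq mult_left_mono)
  then have stay: "?\<mu> y < ?\<nu> y" "?\<nu> x < ?\<mu> x"
    using V xy yx a by (auto simp: lazy_measure_def)
  have tight: "dist_G u v \<le> f u - f v" if "?\<nu> u < ?\<mu> u" "?\<mu> v < ?\<nu> v" for u v
  proof -
    have "?\<mu> u \<noteq> 0" "?\<nu> v \<noteq> 0"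
      using that lazy_measure_nonneg[OF pos V(1), of \<alpha> v] lazy_measure_nonneg[OF pos V(2), of \<alpha> u] a
      by auto
    moreover have "u \<noteq> y" "v \<noteq> x" using that stay by auto
    ultimately show ?thesis using supp_x supp_y exact by (metis order_refl)
  qed
  have W: "wasserstein1 V E ?\<mu> ?\<nu> = (\<Sum>u\<in>V. f u * ?\<mu> u) - (\<Sum>v\<in>V. f v * ?\<nu> v)"
    by (rule wasserstein1_eq_potential_difference)
      (use lazy_measure_nonneg[OF pos] lazy_measure_total[OF pos] V a lip tight dist_self in auto)
  \<comment> \<open>The potential is constant on the neighbours of an end of the edge, except at the other end.\<close>
  have "(\<Sum>z\<in>nbrs x. f z * wt w x z) = (\<Sum>z\<in>nbrs x. 2 * wt w x z - (if z = y then 2 * wt w x y else 0))"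
    using f_left f_y by (intro sum.cong) auto
  then have left: "(\<Sum>z\<in>nbrs x. f z * wt w x z) = 2 * mass w x - 2 * wt w x y"
    using V xy by (simp add: sum_subtractf vertex_mass_def sum_distrib_left)
  have "(\<Sum>z\<in>nbrs y. f z * wt w y z) = (\<Sum>z\<in>nbrs y. (if z = x then 2 * wt w y x else 0) - wt w y z)"
    using f_right f_x by (intro sum.cong) auto
  then have right: "(\<Sum>z\<in>nbrs y. f z * wt w y z) = 2 * wt w x y - mass w y"
    using V yx wt_sym[of w x y] by (simp add: sum_subtractf vertex_mass_def)
  show ?thesis
    unfolding W lazy_measure_mean[OF V(1)] lazy_measure_mean[OF V(2)] left right f_x f_y
    using m by (simp add: field_simps)
qed

lemma lly_curvature_formula:
  assumes pos: "positive_weight w"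
  shows "lly_curvature V E e w $ i = 2 * w $ i * (\<Sum>x\<in>e i. 1 / mass w x) - 2" (is "_ = ?k")
proof -
  let ?Q = "\<lambda>x y \<alpha>. 1 / (1 - \<alpha>) *
    (1 - wasserstein1 V E (lazy_measure V E e w \<alpha> x) (lazy_measure V E e w \<alpha> y))"
  have lim: "(?Q x y \<longlongrightarrow> ?k) (at_left 1)" if exy: "e i = {x, y}" for x y
  proof -
    have xy: "{x, y} \<in> E" "x \<noteq> y" using enum_edge(1)[of i] exy edgeD[of x y] by auto
    have wi: "wt w x y = w $ i" using enum_inj by (simp add: edge_weight_def flip: exy)
    have "\<forall>\<^sub>F \<alpha> in at_left 1. (1 / 2 :: real) < \<alpha> \<and> \<alpha> < 1"
      by (rule eventually_at_leftI[of "1/2"]) auto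
    then have "\<forall>\<^sub>F \<alpha> in at_left 1. ?Q x y \<alpha> = ?k"
    proof eventually_elim
      case (elim \<alpha>)
      then show ?case
        using wasserstein1_lazy[OF pos xy(1), of \<alpha>] xy(2) by (simp add: exy wi)
    qed
    then show ?thesis by (rule tendsto_eventually)
  qed
  obtain x y where exy: "e i = {x, y}" by (rule enum_ends)
  have "(THE k. \<forall>x y. e i = {x, y} \<longrightarrow> (?Q x y \<longlongrightarrow> k) (at_left 1)) = ?k"
  proof (rule the_equality)
    show "\<forall>x y. e i = {x, y} \<longrightarrow> (?Q x y \<longlongrightarrow> ?k) (at_left 1)" using lim by blast
    fix k assume "\<forall>x y. e i = {x, y} \<longrightarrow> (?Q x y \<longlongrightarrow> k) (at_left 1)"
    then have "(?Q x y \<longlongrightarrow> k) (at_left 1)" using exy by blast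
    then show "k = ?k" using lim[OF exy] by (rule tendsto_unique[OF trivial_limit_at_left_real])
  qed
  then show ?thesis by (simp add: lly_curvature_def)
qed

lemma mass_incidence:
  assumes "x \<in> V"
  shows "mass w x = (\<Sum>i | x \<in> e i. w $ i)"
proof -
  have "bij_betw (\<lambda>y. inv e {x, y}) (nbrs x) {i. x \<in> e i}"
  proof (rule bij_betwI')
    fix y z assume "y \<in> nbrs x" "z \<in> nbrs x"
    then have "e (inv e {x, y}) = {x, y}" "e (inv e {x, z}) = {x, z}"
      by (simp_all add: enum_inv)
    then show "(inv e {x, y} = inv e {x, z}) = (y = z)"
      by (metis doubleton_eq_iff)
  next
    fix y assume "y \<in> nbrs x"
    then show "inv e {x, y} \<in> {i. x \<in> e i}"
      by (simp add: enum_inv)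
  next
    fix i assume "i \<in> {i. x \<in> e i}"
    then obtain y where y: "e i = {x, y}"
      using enum_ends[of i] by (metis insert_iff insert_commute mem_Collect_eq singletonD)
    then have "y \<in> nbrs x"
      using enum_edge(1)[of i] edgeD[of x y] by simp
    moreover have "i = inv e {x, y}"
      using enum_inj by (simp flip: y)
    ultimately show "\<exists>y\<in>nbrs x. i = inv e {x, y}" by blast
  qed
  then show ?thesis
    unfolding vertex_mass_def edge_weight_def by (rule sum.reindex_bij_betw)
qed

text \<open>
  A discrete Gauss-Bonnet formula: regrouped by vertices, the quotients \<open>w $ i / mass w x\<close> add
  up to \<open>1\<close> at each vertex.
\<close>

lemma total_curvature:
  assumes pos: "positive_weight w"
  shows "(\<Sum>i\<in>UNIV. lly_curvature V E e w $ i) = 2 * (real (card V) - real (card E))"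
proof -
  have "(\<Sum>i\<in>UNIV. w $ i * (\<Sum>x\<in>e i. 1 / mass w x))
      = (\<Sum>i\<in>UNIV. \<Sum>x | x \<in> V \<and> x \<in> e i. w $ i / mass w x)"
  proof (rule sum.cong)
    fix i
    have "{x. x \<in> V \<and> x \<in> e i} = e i" using enum_edge(2)[of i] by blast
    then show "w $ i * (\<Sum>x\<in>e i. 1 / mass w x) = (\<Sum>x | x \<in> V \<and> x \<in> e i. w $ i / mass w x)"
      by (simp add: sum_distrib_left)
  qed simp
  also have "\<dots> = (\<Sum>x\<in>V. \<Sum>i | i \<in> UNIV \<and> x \<in> e i. w $ i / mass w x)"
    by (rule sum.swap_restrict) auto
  also have "\<dots> = (\<Sum>x\<in>V. 1)"
  proof (rule sum.cong)
    fix x assume x: "x \<in> V"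
    show "(\<Sum>i | i \<in> UNIV \<and> x \<in> e i. w $ i / mass w x) = 1"
      using mass_incidence[OF x, of w] mass_pos[OF pos x] by (simp flip: sum_divide_distrib)
  qed simp
  finally have "(\<Sum>i\<in>UNIV. w $ i * (\<Sum>x\<in>e i. 1 / mass w x)) = real (card V)" by simp
  moreover have "CARD('n) = card E" using bij_betw_same_card[OF enum] .
  ultimately show ?thesis
    by (simp add: lly_curvature_formula[OF pos] sum_subtractf mult.assoc flip: sum_distrib_left)
qed

lemma lly_curvature_tendsto:
  assumes lim: "(w \<longlongrightarrow> L) F" and pos: "\<forall>\<^sub>F t in F. positive_weight (w t)"
    and L: "positive_weight L"
  shows "((\<lambda>t. lly_curvature V E e (w t) $ i) \<longlongrightarrow> lly_curvature V E e L $ i) F"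
proof -
  have "mass L x \<noteq> 0" if "x \<in> e i" for x
    using mass_pos[OF L, of x] enum_edge(2)[of i] that by fastforce
  moreover have "((\<lambda>t. mass (w t) x) \<longlongrightarrow> mass L x) F" for x
    unfolding vertex_mass_def edge_weight_def by (intro tendsto_intros lim)
  ultimately have "((\<lambda>t. 2 * w t $ i * (\<Sum>x\<in>e i. 1 / mass (w t) x) - 2)
      \<longlongrightarrow> 2 * L $ i * (\<Sum>x\<in>e i. 1 / mass L x) - 2) F"
    by (intro tendsto_intros lim) auto
  then have formula: "((\<lambda>t. 2 * w t $ i * (\<Sum>x\<in>e i. 1 / mass (w t) x) - 2)
      \<longlongrightarrow> lly_curvature V E e L $ i) F"
    by (simp only: lly_curvature_formula[OF L])
  have "\<forall>\<^sub>F t in F. lly_curvature V E e (w t) $ i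
      = 2 * w t $ i * (\<Sum>x\<in>e i. 1 / mass (w t) x) - 2"
    using pos by eventually_elim (rule lly_curvature_formula)
  from tendsto_cong[OF this] formula show ?thesis by (rule iffD2)
qed

end

section \<open>Convergent solutions of the flow\<close>

text \<open>
  By the mean value theorem, the increments of \<open>g\<close> over intervals of length \<open>1\<close> are values of \<open>g'\<close>
  at points tending to infinity. They tend to \<open>0\<close> and to the limit of \<open>g'\<close>.
\<close>

lemma derivative_limit_zero:
  fixes g g' :: "real \<Rightarrow> real"
  assumes der: "\<And>t. 0 < t \<Longrightarrow> (g has_real_derivative g' t) (at t)"
    and g: "(g \<longlongrightarrow> l) at_top" and g': "(g' \<longlongrightarrow> c) at_top"
  shows "c = 0"
proof -
  have "\<exists>z. t < z \<and> g (t + 1) - g t = g' z" if "0 < t" for t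
  proof -
    have "(g has_real_derivative g' s) (at s)" if "t \<le> s" for s
      using der \<open>0 < t\<close> that by simp
    then show ?thesis using MVT2[of t "t + 1" g g'] by auto
  qed
  then obtain z where z: "\<And>t. 0 < t \<Longrightarrow> t < z t" "\<And>t. 0 < t \<Longrightarrow> g (t + 1) - g t = g' (z t)"
    by metis
  have "\<forall>\<^sub>F t in at_top. t \<le> z t"
    using eventually_gt_at_top[of 0] by eventually_elim (rule less_imp_le[OF z(1)])
  with filterlim_ident have "filterlim z at_top at_top" by (rule filterlim_at_top_mono)
  with g' have "((\<lambda>t. g' (z t)) \<longlongrightarrow> c) at_top" by (rule filterlim_compose)
  moreover have "\<forall>\<^sub>F t in at_top. g' (z t) = g (t + 1) - g t"
    using eventually_gt_at_top[of 0] by eventually_elim (rule z(2)[symmetric])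
  ultimately have increment: "((\<lambda>t. g (t + 1) - g t) \<longlongrightarrow> c) at_top"
    by (rule Lim_transform_eventually)
  have "((\<lambda>t. g (t + 1)) \<longlongrightarrow> l) at_top"
    by (rule filterlim_compose[OF g])
      (rule filterlim_at_top_mono[OF filterlim_ident], simp)
  then have "((\<lambda>t. g (t + 1) - g t) \<longlongrightarrow> l - l) at_top" using g by (rule tendsto_diff)
  then have "c = l - l" by (rule tendsto_unique[OF trivial_limit_at_top_linorder increment])
  then show ?thesis by simp
qed

context girth_six_graph
begin

lemma flow_log_derivative:
  assumes flow: "flow_solution V E e \<kappa>s w0 w" and t: "0 \<le> t"
  shows "((\<lambda>t. ln (w t $ i)) has_real_derivative
    - (lly_curvature V E e (w t) $ i - \<kappa>s $ i)) (at t within {0..})"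
proof -
  have pos: "0 < w t $ i" and d: "(w has_vector_derivative
      (\<chi> i. - (lly_curvature V E e (w t) $ i - \<kappa>s $ i) * w t $ i)) (at t within {0..})"
    using flow t by (auto simp: flow_solution_def positive_weight_def)
  have "((\<lambda>t. w t $ i) has_real_derivative
      - (lly_curvature V E e (w t) $ i - \<kappa>s $ i) * w t $ i) (at t within {0..})"
    using bounded_linear.has_vector_derivative[OF bounded_linear_vec_nth d, of i]
    by (simp add: has_real_derivative_iff_has_vector_derivative)
  from DERIV_chain'[OF this DERIV_ln_divide[OF pos]] show ?thesis using pos by simp
qed

text \<open>
  The logarithmic derivatives \<open>\<kappa>s $ i - lly_curvature V E e (w t) $ i\<close> add up to \<open>0\<close>, because the
  prescribed and the actual curvature have the same total.
\<close>

lemma flow_product_conserved: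
  assumes flow: "flow_solution V E e \<kappa>s w0 w"
    and total: "(\<Sum>i\<in>UNIV. \<kappa>s $ i) = 2 * (real (card V) - real (card E))"
    and t: "0 \<le> t"
  shows "(\<Prod>i\<in>UNIV. w t $ i) = (\<Prod>i\<in>UNIV. w0 $ i)"
proof -
  have pos: "positive_weight (w s)" if "0 \<le> s" for s
    using flow that by (auto simp: flow_solution_def)
  have "((\<lambda>s. \<Sum>i\<in>UNIV. ln (w s $ i)) has_real_derivative 0) (at s within {0..})"
    if s: "s \<in> {0..}" for s
  proof -
    have "((\<lambda>s. \<Sum>i\<in>UNIV. ln (w s $ i)) has_real_derivative
        (\<Sum>i\<in>UNIV. - (lly_curvature V E e (w s) $ i - \<kappa>s $ i))) (at s within {0..})"
      using flow_log_derivative[OF flow] s by (intro DERIV_sum) auto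
    then show ?thesis
      using total total_curvature[OF pos, of s] s by (simp add: sum_subtractf)
  qed
  then have "\<exists>c. \<forall>s\<in>{0..}. (\<Sum>i\<in>UNIV. ln (w s $ i)) = c"
    by (intro has_field_derivative_zero_constant) auto
  then have c: "(\<Sum>i\<in>UNIV. ln (w t $ i)) = (\<Sum>i\<in>UNIV. ln (w 0 $ i))" using t by fastforce
  have "(\<Prod>i\<in>UNIV. w s $ i) = exp (\<Sum>i\<in>UNIV. ln (w s $ i))" if "0 \<le> s" for s
    using pos[OF that] by (simp add: exp_sum positive_weight_def)
  from this[of t] this[of 0] show ?thesis using c t flow by (simp add: flow_solution_def)
qed

text \<open>
  The coordinates of the limit are nonnegative, and their product is still that of the initial
  weights, hence not \<open>0\<close>.
\<close>

lemma flow_limit_positive: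
  assumes flow: "flow_solution V E e \<kappa>s w0 w" and w0: "positive_weight w0"
    and total: "(\<Sum>i\<in>UNIV. \<kappa>s $ i) = 2 * (real (card V) - real (card E))"
    and lim: "(w \<longlongrightarrow> L) at_top"
  shows "positive_weight L"
proof -
  have "((\<lambda>t. \<Prod>i\<in>UNIV. w t $ i) \<longlongrightarrow> (\<Prod>i\<in>UNIV. L $ i)) at_top"
    by (intro tendsto_prod tendsto_vec_nth lim)
  moreover have "\<forall>\<^sub>F t in at_top. (\<Prod>i\<in>UNIV. w t $ i) = (\<Prod>i\<in>UNIV. w0 $ i)"
    using eventually_ge_at_top[of 0]
    by eventually_elim (rule flow_product_conserved[OF flow total])
  then have "((\<lambda>t. \<Prod>i\<in>UNIV. w t $ i) \<longlongrightarrow> (\<Prod>i\<in>UNIV. w0 $ i)) at_top"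
    by (rule tendsto_eventually)
  ultimately have "(\<Prod>i\<in>UNIV. L $ i) = (\<Prod>i\<in>UNIV. w0 $ i)"
    by (rule tendsto_unique[OF trivial_limit_at_top_linorder])
  moreover have "0 < (\<Prod>i\<in>UNIV. w0 $ i)"
    using w0 by (intro prod_pos) (auto simp: positive_weight_def)
  ultimately have "(\<Prod>i\<in>UNIV. L $ i) \<noteq> 0" by linarith
  then have "L $ i \<noteq> 0" for i by simp
  moreover have "0 \<le> L $ i" for i
    using tendsto_vec_nth[OF lim, of i]
  proof (rule tendsto_lowerbound)
    show "\<forall>\<^sub>F t in at_top. 0 \<le> w t $ i"
      using eventually_ge_at_top[of 0]
      by eventually_elim (use flow in \<open>auto simp: flow_solution_def positive_weight_def less_imp_le\<close>)
  qed simp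
  ultimately show ?thesis by (simp add: positive_weight_def less_le)
qed

lemma flow_limit_curvature:
  assumes flow: "flow_solution V E e \<kappa>s w0 w"
    and lim: "(w \<longlongrightarrow> L) at_top" and L: "positive_weight L"
  shows "lly_curvature V E e L $ i = \<kappa>s $ i"
proof -
  have "\<forall>\<^sub>F t in at_top. positive_weight (w t)"
    using eventually_ge_at_top[of 0] by eventually_elim (use flow in \<open>auto simp: flow_solution_def\<close>)
  then have derivative: "((\<lambda>t. - (lly_curvature V E e (w t) $ i - \<kappa>s $ i)) \<longlongrightarrow>
      - (lly_curvature V E e L $ i - \<kappa>s $ i)) at_top"
    by (intro tendsto_intros lly_curvature_tendsto lim L)
  have logarithm: "((\<lambda>t. ln (w t $ i)) \<longlongrightarrow> ln (L $ i)) at_top"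
    using L by (intro tendsto_ln tendsto_vec_nth lim) (auto simp: positive_weight_def dual_order.strict_implies_not_eq)
  have has_derivative: "((\<lambda>t. ln (w t $ i)) has_real_derivative
      - (lly_curvature V E e (w t) $ i - \<kappa>s $ i)) (at t)" if "0 < t" for t
    using flow_log_derivative[OF flow, of t i] that at_within_interior[of t "{0..}"] by simp
  have "- (lly_curvature V E e L $ i - \<kappa>s $ i) = 0"
    by (rule derivative_limit_zero[OF has_derivative logarithm derivative])
  then show ?thesis by simp
qed

end

theorem theorem3p3:
  fixes V :: "'v set" and E :: "'v set set" and e :: "'n::finite \<Rightarrow> 'v set"
    and \<kappa>s w0 :: "real ^ 'n" and w :: "real \<Rightarrow> real ^ 'n"
  assumes "simple_graph V E"
    and "graph_connected V E"
    and "6 \<le> girth V E"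
    and "bij_betw e UNIV E"
    and "(\<Sum>i\<in>UNIV. \<kappa>s $ i) = 2 * (real (card V) - real (card E))"
    and "positive_weight w0"
    and "flow_solution V E e \<kappa>s w0 w"
    and "\<exists>L. (w \<longlongrightarrow> L) at_top"
  shows "(\<exists>ws. weight_of_curvature V E e \<kappa>s ws)
    \<and> (\<forall>L. (w \<longlongrightarrow> L) at_top \<longrightarrow> weight_of_curvature V E e \<kappa>s L)"
proof -
  interpret girth_six_graph V E e
    using assms(1-4) by unfold_locales
  have "weight_of_curvature V E e \<kappa>s L" if "(w \<longlongrightarrow> L) at_top" for L
    using flow_limit_positive[OF assms(7,6,5) that] flow_limit_curvature[OF assms(7) that]
    by (simp add: weight_of_curvature_def)
  then show ?thesis using assms(8) by blast
qed

end
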